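(* Let $A$ be a nonzero $n\times n$ complex matrix with cycle decomposition $A=\sum_{i=0}^{n-1}\Lambda_iC^i$, $\Lambda_i$ diagonal, and let $B=WAW^\dagger$. Let $S_k=\{a_1,\dots,a_k\}\subseteq\{0,1,\dots,n-1\}$ be a set of $k$ distinct frequency indices, let $E_i$ be the partial energy of the frequencies $S_k$ on the cycle $i$ of $A$ ($0\le i\le n-1$), and let $T_k=\{b_1,\dots,b_k\}$ with $b_j=0$ if $a_j=0$ and $b_j=n-a_j$ otherwise. Then the cycles of $B$ indexed by $T_k$ have relative magnitude $$s=\sum_{i=0}^{n-1}w_iE_i,$$ where $w_i=\|\Lambda_i\|_F^2/\|A\|_F^2$ is the relative weight of the cycle $i$ in $A$, so that $0\le w_i\le 1$ and $\sum_{i=0}^{n-1} w_i=1$.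
   Context: Rows and columns of $n\times n$ matrices are indexed by $0,1,\dots,n-1$. $C$ is the cyclic permutation matrix with $C(p,q)=1$ if $p\equiv q+1\pmod n$ and $0$ otherwise. Every $n\times n$ matrix $M$ has a unique cycle decomposition $M=\sum_{i=0}^{n-1}\Lambda_iC^i$ with $\Lambda_i$ diagonal, where $\Lambda_iC^i=M\circ C^i$ (Hadamard product); $\Lambda_i$ gives the $i$-th cycle of $M$. $W$ is the unitary matrix $W(p,q)=\frac1{\sqrt n}e^{-\sqrt{-1}\,2\pi pq/n}$, $W^\dagger$ its conjugate transpose, and $\|\cdot\|_F$ is the Frobenius norm. Discrete Fourier transform: the DFT of $\{x(p)\}_{p=0}^{n-1}$ is $X(m)=\sum_{p=0}^{n-1}x(p)e^{\sqrt{-1}\,2\pi pm/n}$, $0\le m\le n-1$. Partial energy: let $\gamma^i_m$ ($0\le m\le n-1$) be the DFT of the diagonal entries $\{\Lambda_i(p,p)\}_{p=0}^{n-1}$ of the $i$-th cycle of $A$. The partial energy of the frequencies $S_k$ on the cycle $i$ is $E_i=\dfrac{\sum_{m\in S_k}|\gamma^i_m|^2}{\sum_{m=0}^{n-1}|\gamma^i_m|^2}$ (if $\Lambda_i=0$, $E_i$ may be taken to be any number in $[0,1]$). Relative magnitude: if $B=\sum_{j=0}^{n-1}\tilde\Lambda_jC^j$ is the cycle decomposition of $B\neq 0$, the relative magnitude of the cycles of $B$ indexed by a set $T$ is $s=\dfrac{\sum_{j\in T}\|\tilde\Lambda_j\|_F^2}{\|B\|_F^2}$. *)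

theory Defs
  imports Complex_Main "Jordan_Normal_Form.Schur_Decomposition"
begin

definition cyclic_perm_mat :: "nat \<Rightarrow> complex mat" where
  "cyclic_perm_mat n = mat n n (\<lambda>(p, q). if p mod n = (q + 1) mod n then 1 else 0)"

definition cycle_decomposition :: "nat \<Rightarrow> complex mat \<Rightarrow> (nat \<Rightarrow> complex mat) \<Rightarrow> bool" where
  "cycle_decomposition n M L \<longleftrightarrow>
     (\<forall>i<n. L i \<in> carrier_mat n n \<and> diagonal_mat (L i)) \<and>
     M = finsum (module_mat TYPE(complex) n n) (\<lambda>i. L i * cyclic_perm_mat n ^\<^sub>m i) {0..<n}"

definition fourier_mat :: "nat \<Rightarrow> complex mat" where
  "fourier_mat n = mat n n (\<lambda>(p, q).
     1 / complex_of_real (sqrt (real n)) *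
     exp (- \<i> * complex_of_real (2 * pi * real p * real q / real n)))"

definition frobenius_norm :: "complex mat \<Rightarrow> real" where
  "frobenius_norm M = sqrt (\<Sum>p<dim_row M. \<Sum>q<dim_col M. (cmod (M $$ (p, q)))\<^sup>2)"

(* The sign of the exponent is opposite to the one in fourier_mat, and there is no normalisation. *)
definition dft :: "nat \<Rightarrow> (nat \<Rightarrow> complex) \<Rightarrow> nat \<Rightarrow> complex" where
  "dft n x m = (\<Sum>p<n. x p * exp (\<i> * complex_of_real (2 * pi * real p * real m / real n)))"

(* A relation rather than a function: on a vanishing cycle D = 0 the partial energy may be any
   number in [0,1].  D is the diagonal matrix giving the cycle. *)
definition is_partial_energy :: "nat \<Rightarrow> nat set \<Rightarrow> complex mat \<Rightarrow> real \<Rightarrow> bool" where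
  "is_partial_energy n S D e \<longleftrightarrow>
     (if D = 0\<^sub>m n n then 0 \<le> e \<and> e \<le> 1
      else e = (\<Sum>m\<in>S. (cmod (dft n (\<lambda>p. D $$ (p, p)) m))\<^sup>2) /
               (\<Sum>m<n. (cmod (dft n (\<lambda>p. D $$ (p, p)) m))\<^sup>2))"

(* The cycle decomposition exists and is unique, see cycle_decomposition_exists and
   cycle_decomposition_unique below. *)
definition has_relative_magnitude :: "nat \<Rightarrow> complex mat \<Rightarrow> nat set \<Rightarrow> real \<Rightarrow> bool" where
  "has_relative_magnitude n B T s \<longleftrightarrow>
     B \<noteq> 0\<^sub>m n n \<and>
     (\<exists>L. cycle_decomposition n B L \<and>
          s = (\<Sum>j\<in>T. (frobenius_norm (L j))\<^sup>2) / (frobenius_norm B)\<^sup>2)"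


lemma cyclic_perm_mat_carrier [simp]: "cyclic_perm_mat n \<in> carrier_mat n n"
  by (simp add: cyclic_perm_mat_def)

lemma cyclic_perm_mat_pow_carrier [simp]: "cyclic_perm_mat n ^\<^sub>m i \<in> carrier_mat n n"
  by (rule pow_carrier_mat) simp

lemma cyclic_perm_mat_pow_index:
  assumes "p < n" "q < n"
  shows "(cyclic_perm_mat n ^\<^sub>m i) $$ (p, q) = (if p = (q + i) mod n then 1 else 0)"
  using assms
proof (induction i arbitrary: q)
  case 0
  have "dim_row (cyclic_perm_mat n) = n" by (simp add: cyclic_perm_mat_def)
  then show ?case using 0 by auto
next
  case (Suc i)
  let ?C = "cyclic_perm_mat n"
  have "dim_row (?C ^\<^sub>m i) = n" "dim_col (?C ^\<^sub>m i) = n"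
    using carrier_matD[OF cyclic_perm_mat_pow_carrier[of n i]] by blast+
  then have "(?C ^\<^sub>m Suc i) $$ (p, q) = (\<Sum>r<n. (?C ^\<^sub>m i) $$ (p, r) * ?C $$ (r, q))"
    using Suc.prems by (simp add: cyclic_perm_mat_def scalar_prod_def atLeast0LessThan)
  also have "\<dots> = (\<Sum>r<n. if r = (q + 1) mod n then (?C ^\<^sub>m i) $$ (p, r) else 0)"
    using Suc.prems by (intro sum.cong) (auto simp: cyclic_perm_mat_def)
  also have "\<dots> = (?C ^\<^sub>m i) $$ (p, (q + 1) mod n)"
    using Suc.prems by (simp add: sum.delta)
  also have "\<dots> = (if p = ((q + 1) mod n + i) mod n then 1 else 0)"
    using Suc.prems by (intro Suc.IH) auto
  also have "((q + 1) mod n + i) mod n = (q + Suc i) mod n"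
    by (simp add: mod_simps)
  finally show ?case .
qed

lemma finsum_mat_carrier_index:
  assumes "finite I" "\<And>i. i \<in> I \<Longrightarrow> f i \<in> carrier_mat n n"
  shows "finsum (module_mat TYPE(complex) n n) f I \<in> carrier_mat n n \<and>
    (\<forall>p<n. \<forall>q<n. finsum (module_mat TYPE(complex) n n) f I $$ (p, q) = (\<Sum>i\<in>I. f i $$ (p, q)))"
  using assms
proof (induction I rule: finite_induct)
  case empty
  interpret abelian_group "module_mat TYPE(complex) n n" by (rule abelian_group_mat)
  show ?case by (simp add: module_mat_simps)
next
  case (insert j I)
  interpret abelian_group "module_mat TYPE(complex) n n" by (rule abelian_group_mat)
  have "finsum (module_mat TYPE(complex) n n) f (insert j I)
      = f j + finsum (module_mat TYPE(complex) n n) f I"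
    using insert by (subst finsum_insert) (auto simp: module_mat_simps)
  then show ?case using insert by auto
qed

lemma diagonal_times_cycle_index:
  assumes "D \<in> carrier_mat n n" "diagonal_mat D" "p < n" "q < n"
  shows "(D * cyclic_perm_mat n ^\<^sub>m i) $$ (p, q) = (if p = (q + i) mod n then D $$ (p, p) else 0)"
proof -
  let ?P = "cyclic_perm_mat n ^\<^sub>m i"
  have "dim_row ?P = n" "dim_col ?P = n"
    using carrier_matD[OF cyclic_perm_mat_pow_carrier[of n i]] by blast+
  then have "(D * ?P) $$ (p, q) = (\<Sum>r<n. D $$ (p, r) * ?P $$ (r, q))"
    using assms by (simp add: scalar_prod_def atLeast0LessThan)
  also have "\<dots> = (\<Sum>r<n. if r = p then D $$ (p, p) * ?P $$ (p, q) else 0)"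
    using assms by (intro sum.cong) (auto simp: diagonal_mat_def)
  finally show ?thesis
    using assms by (simp add: cyclic_perm_mat_pow_index)
qed

lemma mod_less_twice:
  fixes x n :: nat
  assumes "x < 2 * n"
  shows "x mod n = (if x < n then x else x - n)"
  using assms by (simp add: le_mod_geq)

lemma mod_diff_unique:
  fixes n p q i :: nat
  assumes "p < n" "q < n" "i < n"
  shows "p = (q + i) mod n \<longleftrightarrow> i = (p + n - q) mod n"
proof -
  have "q + i < 2 * n" "p + n - q < 2 * n" using assms by linarith+
  then show ?thesis
    using assms by (simp add: mod_less_twice) linarith
qed

lemma mod_diff_diff:
  fixes n p q :: nat
  assumes "p < n" "q < n"
  shows "(p + n - (p + n - q) mod n) mod n = q"
proof -
  have "p + n - q < 2 * n" "p + n - (p + n - q) mod n < 2 * n"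
    using assms by linarith+
  then show ?thesis
    using assms by (simp add: mod_less_twice)
qed

lemma cycle_decomposition_iff:
  "cycle_decomposition n M L \<longleftrightarrow>
     (\<forall>i<n. L i \<in> carrier_mat n n \<and> diagonal_mat (L i)) \<and>
     M \<in> carrier_mat n n \<and> (\<forall>p<n. \<forall>q<n. M $$ (p, q) = L ((p + n - q) mod n) $$ (p, p))"
proof (cases "\<forall>i<n. L i \<in> carrier_mat n n \<and> diagonal_mat (L i)")
  case True
  let ?f = "\<lambda>i. L i * cyclic_perm_mat n ^\<^sub>m i"
  let ?S = "finsum (module_mat TYPE(complex) n n) ?f {0..<n}"
  have fc: "?f i \<in> carrier_mat n n" if "i \<in> {0..<n}" for i
    using True that by (intro mult_carrier_mat[of _ n n]) auto
  have fin: "?S \<in> carrier_mat n n \<and>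
      (\<forall>p<n. \<forall>q<n. ?S $$ (p, q) = (\<Sum>i\<in>{0..<n}. ?f i $$ (p, q)))"
    by (intro finsum_mat_carrier_index finite_atLeastLessThan fc)
  then have car: "?S \<in> carrier_mat n n" by blast
  have ind: "?S $$ (p, q) = (\<Sum>i\<in>{0..<n}. ?f i $$ (p, q))" if "p < n" "q < n" for p q
    using fin that by blast
  have ent: "?S $$ (p, q) = L ((p + n - q) mod n) $$ (p, p)" if "p < n" "q < n" for p q
  proof -
    have "?S $$ (p, q) = (\<Sum>i\<in>{0..<n}. if i = (p + n - q) mod n then L i $$ (p, p) else 0)"
      unfolding ind[OF that]
    proof (intro sum.cong refl)
      fix i assume "i \<in> {0..<n}"
      then have i: "i < n" by simp
      show "?f i $$ (p, q) = (if i = (p + n - q) mod n then L i $$ (p, p) else 0)"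
        using True i diagonal_times_cycle_index[of "L i" n p q i] that
        unfolding mod_diff_unique[OF that i] by blast
    qed
    also have "\<dots> = L ((p + n - q) mod n) $$ (p, p)"
      using that by (subst sum.delta) auto
    finally show ?thesis .
  qed
  have "M = ?S" if "M \<in> carrier_mat n n"
    and "\<forall>p<n. \<forall>q<n. M $$ (p, q) = L ((p + n - q) mod n) $$ (p, p)"
  proof (rule eq_matI)
    show "dim_row M = dim_row ?S" "dim_col M = dim_col ?S"
      unfolding carrier_matD[OF car] carrier_matD[OF that(1)] by (rule refl)+
    fix p q assume "p < dim_row ?S" "q < dim_col ?S"
    then have "p < n" "q < n" unfolding carrier_matD[OF car] .
    then show "M $$ (p, q) = ?S $$ (p, q)"
      unfolding ent[OF \<open>p < n\<close> \<open>q < n\<close>] using that(2) by blast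
  qed
  moreover have "M \<in> carrier_mat n n \<and>
      (\<forall>p<n. \<forall>q<n. M $$ (p, q) = L ((p + n - q) mod n) $$ (p, p))" if "M = ?S"
    unfolding that using car ent by blast
  ultimately have "M = ?S \<longleftrightarrow> M \<in> carrier_mat n n \<and>
      (\<forall>p<n. \<forall>q<n. M $$ (p, q) = L ((p + n - q) mod n) $$ (p, p))"
    by blast
  then show ?thesis
    using True unfolding cycle_decomposition_def by blast
next
  case False
  then show ?thesis unfolding cycle_decomposition_def by blast
qed

lemma cycle_decomposition_exists:
  assumes "M \<in> carrier_mat n n"
  shows "\<exists>L. cycle_decomposition n M L"
proof -
  define L where "L = (\<lambda>i. mat n n (\<lambda>(p, q). if p = q then M $$ (p, (p + n - i) mod n) else 0))"
  have "cycle_decomposition n M L"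
    using assms unfolding cycle_decomposition_iff by (auto simp: L_def diagonal_mat_def mod_diff_diff)
  then show ?thesis by blast
qed

lemma cycle_decomposition_unique:
  assumes "cycle_decomposition n M L" "cycle_decomposition n M L'" "i < n"
  shows "L i = L' i"
proof (rule eq_matI)
  have car: "L i \<in> carrier_mat n n" "L' i \<in> carrier_mat n n"
    and diag: "diagonal_mat (L i)" "diagonal_mat (L' i)"
    using assms by (auto simp: cycle_decomposition_def)
  show "dim_row (L i) = dim_row (L' i)" "dim_col (L i) = dim_col (L' i)"
    using car by auto
  fix p q assume pq: "p < dim_row (L' i)" "q < dim_col (L' i)"
  then have pqn: "p < n" "q < n" using car by auto
  have "(p + n - (p + n - i) mod n) mod n = i"
    using pqn assms(3) by (simp add: mod_diff_diff)
  moreover have "(p + n - i) mod n < n" using pqn by simp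
  ultimately have "L i $$ (p, p) = L' i $$ (p, p)"
    using assms pqn unfolding cycle_decomposition_iff by metis
  then show "L i $$ (p, q) = L' i $$ (p, q)"
    using diag car pqn by (cases "p = q") (auto simp: diagonal_mat_def)
qed

lemma cycle_decomposition_hadamard:
  assumes "cycle_decomposition n M L" "i < n" "p < n" "q < n"
  shows "(L i * cyclic_perm_mat n ^\<^sub>m i) $$ (p, q) = M $$ (p, q) * (cyclic_perm_mat n ^\<^sub>m i) $$ (p, q)"
proof -
  have "L i \<in> carrier_mat n n" "diagonal_mat (L i)"
    and M: "M $$ (p, q) = L ((p + n - q) mod n) $$ (p, p)"
    using assms unfolding cycle_decomposition_iff by blast+
  then show ?thesis
    using assms(2-4) unfolding M
    by (simp add: diagonal_times_cycle_index cyclic_perm_mat_pow_index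
        mod_diff_unique[OF assms(3,4,2)] del: index_mult_mat)
qed

end

theory Submission
  imports Defs
begin

text \<open>
  Write \<open>\<omega> = exp (2 \<pi> \<i> / n)\<close>, let \<open>\<lambda>\<^sub>i\<close> be the diagonal of the \<open>i\<close>-th cycle of \<open>A\<close>, and let
  \<open>\<gamma>\<^sub>i\<close> be its discrete Fourier transform. Grouping the double sum for an entry of \<open>B = W A W\<^sup>\<dagger>\<close>
  by cycles of \<open>A\<close>, that is, replacing the column index by \<open>r - i\<close> in row \<open>r\<close>, gives
  \<open>B(p, q) = (1/n) (\<Sum>i. \<omega>\<^bsup>-iq\<^esup> \<gamma>\<^sub>i(q - p))\<close>, with indices modulo \<open>n\<close>
  (lemma \<open>fourier_conjugate_index_dft\<close>).
  On the \<open>j\<close>-th cycle of \<open>B\<close> the difference \<open>q - p\<close> is constantly \<open>-j\<close>, so this cycle contains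
  a single frequency \<open>m = -j\<close> of all the cycles of \<open>A\<close>; along it, the entries are, up to
  conjugation and the factor \<open>1/n\<close>, a Fourier transform in the variable \<open>i\<close>.

  Parseval's identity in \<open>i\<close> therefore gives that the \<open>j\<close>-th cycle of \<open>B\<close> has squared norm
  \<open>(1/n) (\<Sum>i. |\<gamma>\<^sub>i(-j)|\<^sup>2)\<close> (lemma \<open>frobenius_norm_sq_fourier_cycle\<close>). The map \<open>a \<mapsto> b\<close> of the
  theorem is negation modulo \<open>n\<close>, so summing over \<open>T\<close> amounts to summing \<open>|\<gamma>\<^sub>i(m)|\<^sup>2 / n\<close> over
  \<open>m \<in> S\<close> and over \<open>i\<close>. By Parseval's identity in the frequency, the part belonging to \<open>i\<close> is
  \<open>E\<^sub>i\<close> times the squared norm of the \<open>i\<close>-th cycle of \<open>A\<close>. The same computation over all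
  frequencies shows that \<open>A\<close> and \<open>B\<close> have equal Frobenius norms, and dividing by them gives the
  weighted sum.
\<close>

section \<open>The discrete Fourier transform\<close>

definition root_unity :: "nat \<Rightarrow> complex" where
  "root_unity n = cis (2 * pi / real n)"

lemma root_unity_power_cnj [simp]:
  "root_unity n ^ k * cnj (root_unity n) ^ k = 1" "cnj (root_unity n) ^ k * root_unity n ^ k = 1"
  by (simp_all add: root_unity_def cis_cnj cis_mult flip: power_mult_distrib)

lemma root_unity_power_cis: "root_unity n ^ k = cis (2 * pi * real k / real n)"
  by (simp add: root_unity_def DeMoivre mult_ac)

lemma root_unity_power: "root_unity n ^ k = exp (\<i> * complex_of_real (2 * pi * real k / real n))"
  by (simp only: root_unity_power_cis cis_conv_exp)

lemma root_unity_power_n: "0 < n \<Longrightarrow> root_unity n ^ n = 1"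
  by (simp add: root_unity_def DeMoivre)

lemma root_unity_power_cong:
  assumes "0 < n" "k mod n = l mod n"
  shows "root_unity n ^ k = root_unity n ^ l"
proof -
  have red: "root_unity n ^ j = root_unity n ^ (j mod n)" for j
  proof -
    have "root_unity n ^ j = root_unity n ^ (n * (j div n) + j mod n)" by simp
    also have "\<dots> = root_unity n ^ (j mod n)"
      unfolding power_add power_mult by (simp add: root_unity_power_n assms(1))
    finally show ?thesis .
  qed
  show ?thesis using red[of k] red[of l] assms(2) by simp
qed

text \<open>
  Conjugation inverts a root of unity, so a congruence of exponents can be solved for one of its
  terms; this avoids subtraction of natural numbers in exponents.
\<close>
lemma root_unity_power_diff:
  assumes "0 < n" "(k + l) mod n = m mod n"
  shows "cnj (root_unity n ^ k) * root_unity n ^ m = root_unity n ^ l"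
proof -
  have "root_unity n ^ m = root_unity n ^ k * root_unity n ^ l"
    using root_unity_power_cong[OF assms] by (simp add: power_add)
  then have "cnj (root_unity n ^ k) * root_unity n ^ m
      = (cnj (root_unity n) ^ k * root_unity n ^ k) * root_unity n ^ l"
    by (simp add: mult.assoc)
  then show ?thesis by simp
qed

lemma inj_on_root_unity_power:
  assumes "0 < n"
  shows "inj_on (\<lambda>k. root_unity n ^ k) {..<n}"
  using bij_betw_imp_inj_on[OF bij_betw_roots_unity[OF assms]]
  by (simp add: root_unity_power_cis)

text \<open>
  The summands are the powers of \<open>z = \<omega>\<^bsup>p - q\<^esup>\<close>. For \<open>p \<noteq> q\<close> this is an \<open>n\<close>-th root of unity other
  than 1, because \<open>\<omega>\<close> is primitive, and the geometric sum vanishes.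
\<close>
lemma root_unity_orthogonal:
  assumes "p < n" "q < n"
  shows "(\<Sum>m<n. root_unity n ^ (p * m) * cnj (root_unity n ^ (q * m)))
    = (if p = q then of_nat n else 0)"
proof -
  have n: "0 < n" using assms by simp
  define z where "z = root_unity n ^ p * cnj (root_unity n) ^ q"
  have z: "root_unity n ^ (p * m) * cnj (root_unity n ^ (q * m)) = z ^ m" for m
    by (simp add: z_def power_mult power_mult_distrib)
  have "z ^ n = (root_unity n ^ n) ^ p * cnj ((root_unity n ^ n) ^ q)"
    by (simp add: z_def power_mult_distrib flip: power_mult) (simp add: mult.commute)
  then have zn: "z ^ n = 1" using n by (simp only: root_unity_power_n) simp
  have "root_unity n ^ p = z * root_unity n ^ q"
    unfolding z_def mult.assoc by simp
  then have "root_unity n ^ p = root_unity n ^ q" if "z = 1" using that by simp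
  then have "z \<noteq> 1" if "p \<noteq> q"
    using that assms inj_onD[OF inj_on_root_unity_power[OF n], of p q] by auto
  then have "p \<noteq> q \<Longrightarrow> (\<Sum>m<n. z ^ m) = 0"
    using geometric_sum[of z n] zn by simp
  moreover have "p = q \<Longrightarrow> z = 1" by (simp add: z_def)
  ultimately show ?thesis unfolding z by simp
qed

lemma dft_root_unity: "dft n x m = (\<Sum>p<n. x p * root_unity n ^ (p * m))"
  by (simp add: dft_def root_unity_power mult.assoc)

text \<open>
  Parseval's identity: expand the square and sum over the frequency first, so that orthogonality
  leaves only the diagonal terms. The factor \<open>n\<close> comes from the missing normalisation of the
  transform.
\<close>
lemma dft_parseval: "(\<Sum>m<n. (cmod (dft n x m))\<^sup>2) = real n * (\<Sum>p<n. (cmod (x p))\<^sup>2)"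
proof -
  let ?r = "\<lambda>p m. root_unity n ^ (p * m)"
  have "complex_of_real (\<Sum>m<n. (cmod (dft n x m))\<^sup>2)
      = (\<Sum>m<n. \<Sum>p<n. \<Sum>q<n. x p * cnj (x q) * (?r p m * cnj (?r q m)))"
    unfolding dft_root_unity of_real_sum complex_norm_square cnj_sum sum_product
    by (simp add: mult_ac)
  also have "\<dots> = (\<Sum>p<n. \<Sum>q<n. x p * cnj (x q) * (\<Sum>m<n. ?r p m * cnj (?r q m)))"
    unfolding sum_distrib_left
    by (subst sum.swap, rule sum.cong[OF refl], rule sum.swap)
  also have "\<dots> = (\<Sum>p<n. \<Sum>q<n. if p = q then x p * cnj (x p) * of_nat n else 0)"
    by (intro sum.cong refl) (auto simp: root_unity_orthogonal simp del: complex_cnj_power)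
  also have "\<dots> = complex_of_real (real n * (\<Sum>p<n. (cmod (x p))\<^sup>2))"
    unfolding of_real_mult of_real_sum complex_norm_square sum_distrib_left by (simp add: mult_ac)
  finally show ?thesis using of_real_eq_iff by blast
qed

section \<open>Frobenius norms of cycles\<close>

lemma frobenius_norm_sq: "(frobenius_norm M)\<^sup>2 = (\<Sum>p<dim_row M. \<Sum>q<dim_col M. (cmod (M $$ (p, q)))\<^sup>2)"
  unfolding frobenius_norm_def by (simp add: sum_nonneg)

lemma frobenius_norm_eq_0_iff:
  assumes "M \<in> carrier_mat n n"
  shows "frobenius_norm M = 0 \<longleftrightarrow> M = 0\<^sub>m n n"
proof
  assume "frobenius_norm M = 0"
  then have "(\<Sum>p<n. \<Sum>q<n. (cmod (M $$ (p, q)))\<^sup>2) = 0"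
    using frobenius_norm_sq[of M] assms by simp
  then have "M $$ (p, q) = 0" if "p < n" "q < n" for p q
    using that by (simp add: sum_nonneg_eq_0_iff sum_nonneg)
  then show "M = 0\<^sub>m n n" using assms by auto
qed (simp add: frobenius_norm_def)

lemma frobenius_norm_sq_diagonal:
  assumes "D \<in> carrier_mat n n" "diagonal_mat D"
  shows "(frobenius_norm D)\<^sup>2 = (\<Sum>p<n. (cmod (D $$ (p, p)))\<^sup>2)"
proof -
  have "(frobenius_norm D)\<^sup>2 = (\<Sum>p<n. \<Sum>q<n. if p = q then (cmod (D $$ (p, p)))\<^sup>2 else 0)"
    unfolding frobenius_norm_sq using assms
    by (intro sum.cong) (auto simp: diagonal_mat_def)
  then show ?thesis by simp
qed

text \<open>
  The next two bijections trade a row or column index for a cycle index: the entry at \<open>(p, q)\<close> lies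
  on the cycle \<open>p - q\<close> modulo \<open>n\<close>.
\<close>
lemma bij_betw_add_mod:
  fixes n j :: nat
  assumes "j < n"
  shows "bij_betw (\<lambda>q. (q + j) mod n) {..<n} {..<n}"
  by (rule bij_betw_byWitness[where f' = "\<lambda>p. (p + n - j) mod n"])
    (use assms in \<open>auto simp: mod_less_twice\<close>)

lemma bij_betw_diff_mod:
  fixes n p :: nat
  assumes "p < n"
  shows "bij_betw (\<lambda>q. (p + n - q) mod n) {..<n} {..<n}"
  by (rule bij_betw_byWitness[where f' = "\<lambda>q. (p + n - q) mod n"])
    (use assms in \<open>auto simp: mod_diff_diff\<close>)

text \<open>
  The cycle is traversed by its column index, since the entries of the Fourier conjugate along a
  cycle form a Fourier transform in that index.
\<close>
lemma frobenius_norm_sq_cycle: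
  assumes "cycle_decomposition n M L" "j < n"
  shows "(frobenius_norm (L j))\<^sup>2 = (\<Sum>q<n. (cmod (M $$ ((q + j) mod n, q)))\<^sup>2)"
proof -
  have L: "L j \<in> carrier_mat n n" "diagonal_mat (L j)"
    and M: "\<And>p q. p < n \<Longrightarrow> q < n \<Longrightarrow> M $$ (p, q) = L ((p + n - q) mod n) $$ (p, p)"
    using assms unfolding cycle_decomposition_iff by blast+
  have "(frobenius_norm (L j))\<^sup>2 = (\<Sum>p<n. (cmod (L j $$ (p, p)))\<^sup>2)"
    using L by (rule frobenius_norm_sq_diagonal)
  also have "\<dots> = (\<Sum>q<n. (cmod (L j $$ ((q + j) mod n, (q + j) mod n)))\<^sup>2)"
    using sum.reindex_bij_betw[OF bij_betw_add_mod[OF assms(2)],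
        of "\<lambda>p. (cmod (L j $$ (p, p)))\<^sup>2"] by simp
  also have "\<dots> = (\<Sum>q<n. (cmod (M $$ ((q + j) mod n, q)))\<^sup>2)"
  proof (intro sum.cong refl)
    fix q assume "q \<in> {..<n}"
    then have "q < n" "(q + j) mod n < n" by auto
    moreover from this have "((q + j) mod n + n - q) mod n = j"
      using mod_diff_unique[of "(q + j) mod n" n q j] assms(2) by simp
    ultimately show "(cmod (L j $$ ((q + j) mod n, (q + j) mod n)))\<^sup>2
        = (cmod (M $$ ((q + j) mod n, q)))\<^sup>2"
      using M by simp
  qed
  finally show ?thesis .
qed

text \<open>
  The cycles partition the positions of the matrix: each column meets each of them exactly once.
\<close>
lemma frobenius_norm_sq_sum_cycles:
  assumes "cycle_decomposition n M L"
  shows "(frobenius_norm M)\<^sup>2 = (\<Sum>j<n. (frobenius_norm (L j))\<^sup>2)"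
proof -
  have M: "M \<in> carrier_mat n n" using assms by (simp add: cycle_decomposition_iff)
  have "(frobenius_norm M)\<^sup>2 = (\<Sum>q<n. \<Sum>p<n. (cmod (M $$ (p, q)))\<^sup>2)"
    unfolding frobenius_norm_sq using M by (subst sum.swap) simp
  also have "\<dots> = (\<Sum>q<n. \<Sum>j<n. (cmod (M $$ ((q + j) mod n, q)))\<^sup>2)"
  proof (rule sum.cong[OF refl])
    fix q assume "q \<in> {..<n}"
    then show "(\<Sum>p<n. (cmod (M $$ (p, q)))\<^sup>2) = (\<Sum>j<n. (cmod (M $$ ((q + j) mod n, q)))\<^sup>2)"
      using sum.reindex_bij_betw[OF bij_betw_add_mod[of q n],
          of "\<lambda>p. (cmod (M $$ (p, q)))\<^sup>2"] by (simp add: add.commute)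
  qed
  also have "\<dots> = (\<Sum>j<n. (frobenius_norm (L j))\<^sup>2)"
    by (subst sum.swap) (simp add: frobenius_norm_sq_cycle[OF assms])
  finally show ?thesis .
qed

section \<open>Fourier conjugation of a cycle decomposition\<close>

lemma fourier_mat_index:
  assumes "p < n" "q < n"
  shows "fourier_mat n $$ (p, q) = cnj (root_unity n ^ (p * q)) / complex_of_real (sqrt (real n))"
proof -
  have "cnj (root_unity n ^ (p * q)) = cis (- (2 * pi * real p * real q / real n))"
    unfolding root_unity_power_cis cis_cnj by (simp add: mult.assoc)
  then show ?thesis using assms by (simp add: fourier_mat_def cis_conv_exp del: complex_cnj_power)
qed

lemma fourier_conjugate_index:
  assumes "A \<in> carrier_mat n n" "p < n" "q < n"
  shows "(fourier_mat n * A * mat_adjoint (fourier_mat n)) $$ (p, q)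
    = (\<Sum>r<n. \<Sum>s<n. cnj (root_unity n ^ (p * r)) * A $$ (r, s) * root_unity n ^ (q * s)) / of_nat n"
proof -
  let ?W = "fourier_mat n"
  let ?c = "complex_of_real (sqrt (real n))"
  have c: "?c * ?c = of_nat n" by (simp flip: of_real_mult)
  have W: "dim_row ?W = n" "dim_col ?W = n" by (simp_all add: fourier_mat_def)
  have adj: "mat_adjoint ?W \<in> carrier_mat n n"
    using W by (auto simp: mat_adjoint_def mat_of_rows_def)
  have adji: "mat_adjoint ?W $$ (s, q) = cnj (?W $$ (q, s))" if "s < n" for s
    using assms that W by (simp add: mat_adjoint_def mat_of_rows_def)
  have WA: "(?W * A) $$ (p, s) = (\<Sum>r<n. ?W $$ (p, r) * A $$ (r, s))" if "s < n" for s
    using assms that W by (simp add: scalar_prod_def atLeast0LessThan)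
  have "(?W * A * mat_adjoint ?W) $$ (p, q)
      = (\<Sum>s<n. (?W * A) $$ (p, s) * mat_adjoint ?W $$ (s, q))"
    using index_mult_mat(1)[of p "?W * A" q "mat_adjoint ?W"] assms W carrier_matD[OF adj]
    by (simp add: scalar_prod_def atLeast0LessThan del: index_mult_mat(1))
  also have "\<dots> = (\<Sum>s<n. \<Sum>r<n. ?W $$ (p, r) * A $$ (r, s) * cnj (?W $$ (q, s)))"
    by (intro sum.cong refl) (simp add: WA adji sum_distrib_right del: index_mult_mat)
  also have "\<dots> = (\<Sum>s<n. \<Sum>r<n.
      cnj (root_unity n ^ (p * r)) * A $$ (r, s) * root_unity n ^ (q * s) / of_nat n)"
    using assms by (intro sum.cong refl) (simp add: fourier_mat_index flip: c)
  finally show ?thesis by (subst sum.swap) (simp add: sum_divide_distrib)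
qed

text \<open>
  Row \<open>r\<close> meets the \<open>i\<close>-th cycle in column \<open>r - i\<close>. With this substitution the exponent splits as
  \<open>-pr + q(r - i) = r(q - p) - iq\<close>, so the sum over \<open>r\<close> is the transform of the \<open>i\<close>-th diagonal at the
  frequency \<open>q - p\<close>.
\<close>
lemma fourier_conjugate_index_dft:
  assumes "cycle_decomposition n A L" "p < n" "q < n"
  shows "(fourier_mat n * A * mat_adjoint (fourier_mat n)) $$ (p, q)
    = (\<Sum>i<n. cnj (root_unity n ^ (i * q)) * dft n (\<lambda>r. L i $$ (r, r)) ((q + n - p) mod n)) / of_nat n"
proof -
  have n: "0 < n" using assms by simp
  have A: "A \<in> carrier_mat n n"
    and Ai: "\<And>r s. r < n \<Longrightarrow> s < n \<Longrightarrow> A $$ (r, s) = L ((r + n - s) mod n) $$ (r, r)"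
    using assms unfolding cycle_decomposition_iff by blast+
  let ?z = "root_unity n"
  let ?m = "(q + n - p) mod n"
  have pow1: "cnj (?z ^ (p * r)) * ?z ^ (q * r) = ?z ^ (r * ?m)" for r
  proof -
    have "p + (q + n - p) = q + n" using assms(2) by simp
    then have "p * r + r * (q + n - p) = r * (q + n)"
      by (metis distrib_left mult.commute)
    then have "(p * r + r * ?m) mod n = (r * (q + n)) mod n"
      using mod_add_cong[OF refl mod_mult_right_eq[of r "q + n - p" n], of "p * r"] by simp
    also have "\<dots> = (q * r) mod n" by (simp add: algebra_simps)
    finally show ?thesis by (rule root_unity_power_diff[OF n])
  qed
  have pow2: "?z ^ (q * ((r + n - i) mod n)) = cnj (?z ^ (i * q)) * ?z ^ (q * r)" if "i < n" for r i
  proof -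
    have "i + (r + n - i) = r + n" using that by simp
    then have "i * q + q * (r + n - i) = q * (r + n)"
      by (metis distrib_left mult.commute)
    then have "(i * q + q * ((r + n - i) mod n)) mod n = (q * (r + n)) mod n"
      using mod_add_cong[OF refl mod_mult_right_eq[of q "r + n - i" n], of "i * q"] by simp
    also have "\<dots> = (q * r) mod n" by (simp add: algebra_simps)
    finally show ?thesis by (rule root_unity_power_diff[OF n, symmetric])
  qed
  have "(\<Sum>s<n. cnj (?z ^ (p * r)) * A $$ (r, s) * ?z ^ (q * s))
      = (\<Sum>i<n. cnj (?z ^ (i * q)) * (L i $$ (r, r) * ?z ^ (r * ?m)))" if r: "r < n" for r
  proof -
    have "(\<Sum>s<n. cnj (?z ^ (p * r)) * A $$ (r, s) * ?z ^ (q * s))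
      = (\<Sum>i<n. cnj (?z ^ (p * r)) * A $$ (r, (r + n - i) mod n) * ?z ^ (q * ((r + n - i) mod n)))"
      using sum.reindex_bij_betw[OF bij_betw_diff_mod[OF r],
          of "\<lambda>s. cnj (?z ^ (p * r)) * A $$ (r, s) * ?z ^ (q * s)"] by simp
    also have "\<dots> = (\<Sum>i<n. cnj (?z ^ (i * q)) * (L i $$ (r, r) * ?z ^ (r * ?m)))"
    proof (intro sum.cong refl)
      fix i assume "i \<in> {..<n}"
      then have i: "i < n" by simp
      have a: "A $$ (r, (r + n - i) mod n) = L i $$ (r, r)"
        using Ai[OF r, of "(r + n - i) mod n"] r i by (simp add: mod_diff_diff)
      show "cnj (?z ^ (p * r)) * A $$ (r, (r + n - i) mod n) * ?z ^ (q * ((r + n - i) mod n))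
          = cnj (?z ^ (i * q)) * (L i $$ (r, r) * ?z ^ (r * ?m))"
        unfolding a pow2[OF i] pow1[symmetric] by (simp only: mult_ac)
    qed
    finally show ?thesis .
  qed
  then have "(\<Sum>r<n. \<Sum>s<n. cnj (?z ^ (p * r)) * A $$ (r, s) * ?z ^ (q * s))
      = (\<Sum>r<n. \<Sum>i<n. cnj (?z ^ (i * q)) * (L i $$ (r, r) * ?z ^ (r * ?m)))"
    by simp
  also have "\<dots> = (\<Sum>i<n. cnj (?z ^ (i * q)) * dft n (\<lambda>r. L i $$ (r, r)) ?m)"
    by (subst sum.swap) (simp add: dft_root_unity sum_distrib_left)
  finally show ?thesis
    using fourier_conjugate_index[OF A assms(2,3)] by simp
qed

text \<open>
  Along the \<open>j\<close>-th cycle of the conjugated matrix the frequency \<open>q - p\<close> stays equal to \<open>-j\<close>, and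
  only the phases \<open>\<omega>\<^bsup>-iq\<^esup>\<close> vary. The entries are thus conjugates of a Fourier transform in the cycle
  index \<open>i\<close>, evaluated at \<open>q\<close>, and Parseval's identity removes the phases.
\<close>
lemma frobenius_norm_sq_fourier_cycle:
  assumes "cycle_decomposition n A L"
    and "cycle_decomposition n (fourier_mat n * A * mat_adjoint (fourier_mat n)) L'" "j < n"
  shows "(frobenius_norm (L' j))\<^sup>2
    = (\<Sum>i<n. (cmod (dft n (\<lambda>r. L i $$ (r, r)) ((n - j) mod n)))\<^sup>2) / real n"
proof -
  let ?g = "\<lambda>i. dft n (\<lambda>r. L i $$ (r, r)) ((n - j) mod n)"
  have "(cmod ((fourier_mat n * A * mat_adjoint (fourier_mat n)) $$ ((q + j) mod n, q)))\<^sup>2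
      = (cmod (dft n (\<lambda>i. cnj (?g i)) q))\<^sup>2 / (real n)\<^sup>2" if "q < n" for q
  proof -
    have m: "(q + n - (q + j) mod n) mod n = (n - j) mod n"
      using that assms(3) by (auto simp: mod_less_twice)
    \<comment> \<open>The transform has phases of the opposite sign; conjugating twice corrects this without
        changing any modulus.\<close>
    have "(\<Sum>i<n. cnj (root_unity n ^ (i * q)) * ?g i) = cnj (dft n (\<lambda>i. cnj (?g i)) q)"
      by (simp add: dft_root_unity mult.commute)
    then show ?thesis
      using fourier_conjugate_index_dft[OF assms(1), of "(q + j) mod n" q] that m
      by (simp add: norm_divide power_divide del: complex_cnj_power index_mult_mat)
  qed
  then have "(frobenius_norm (L' j))\<^sup>2
      = (\<Sum>q<n. (cmod (dft n (\<lambda>i. cnj (?g i)) q))\<^sup>2) / (real n)\<^sup>2"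
    unfolding frobenius_norm_sq_cycle[OF assms(2,3)] by (simp add: sum_divide_distrib)
  also have "\<dots> = (\<Sum>i<n. (cmod (?g i))\<^sup>2) / real n"
    unfolding dft_parseval by (simp add: power2_eq_square)
  finally show ?thesis .
qed

text \<open>
  Sum the previous formula over all cycles: \<open>-j\<close> runs through all frequencies, and Parseval's
  identity turns the energy of each diagonal back into the norm of its cycle.
\<close>
lemma frobenius_norm_fourier_conjugate:
  assumes "A \<in> carrier_mat n n"
  shows "(frobenius_norm (fourier_mat n * A * mat_adjoint (fourier_mat n)))\<^sup>2 = (frobenius_norm A)\<^sup>2"
proof (cases "n = 0")
  case True
  then show ?thesis using assms by (simp add: frobenius_norm_def fourier_mat_def)
next
  case False
  let ?B = "fourier_mat n * A * mat_adjoint (fourier_mat n)"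
  have B: "?B \<in> carrier_mat n n"
    using assms by (auto simp: fourier_mat_def mat_adjoint_def mat_of_rows_def)
  obtain L L' where L: "cycle_decomposition n A L" and L': "cycle_decomposition n ?B L'"
    using cycle_decomposition_exists assms B by meson
  have Li: "L i \<in> carrier_mat n n" "diagonal_mat (L i)" if "i < n" for i
    using L that by (auto simp: cycle_decomposition_def)
  let ?e = "\<lambda>i m. (cmod (dft n (\<lambda>r. L i $$ (r, r)) m))\<^sup>2"
  have "(frobenius_norm ?B)\<^sup>2 = (\<Sum>j<n. (\<Sum>i<n. ?e i ((n - j) mod n)) / real n)"
    unfolding frobenius_norm_sq_sum_cycles[OF L']
    by (intro sum.cong refl frobenius_norm_sq_fourier_cycle[OF L L']) simp
  also have "\<dots> = (\<Sum>m<n. (\<Sum>i<n. ?e i m) / real n)"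
    using sum.reindex_bij_betw[OF bij_betw_diff_mod[of 0 n],
        of "\<lambda>m. (\<Sum>i<n. ?e i m) / real n"] False by simp
  also have "\<dots> = (\<Sum>i<n. (\<Sum>m<n. ?e i m) / real n)"
    unfolding sum_divide_distrib by (rule sum.swap)
  also have "\<dots> = (\<Sum>i<n. (frobenius_norm (L i))\<^sup>2)"
    using False Li by (simp add: dft_parseval frobenius_norm_sq_diagonal[where n = n])
  also have "\<dots> = (frobenius_norm A)\<^sup>2"
    by (simp add: frobenius_norm_sq_sum_cycles[OF L])
  finally show ?thesis .
qed

text \<open>
  Multiplying by the total energy, which is \<open>n\<close> times the squared norm, removes the division
  from the partial energy. On a vanishing cycle both sides are 0, whatever value was chosen for
  \<open>e\<close>.
\<close>
lemma partial_energy_sum: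
  assumes "D \<in> carrier_mat n n" "diagonal_mat D" "is_partial_energy n S D e" "S \<subseteq> {..<n}"
  shows "(\<Sum>m\<in>S. (cmod (dft n (\<lambda>p. D $$ (p, p)) m))\<^sup>2) = real n * (frobenius_norm D)\<^sup>2 * e"
proof -
  have tot: "(\<Sum>m<n. (cmod (dft n (\<lambda>p. D $$ (p, p)) m))\<^sup>2) = real n * (frobenius_norm D)\<^sup>2"
    by (simp add: dft_parseval frobenius_norm_sq_diagonal[OF assms(1,2)])
  show ?thesis
  proof (cases "D = 0\<^sub>m n n")
    case True
    then have "(\<Sum>m\<in>S. (cmod (dft n (\<lambda>p. D $$ (p, p)) m))\<^sup>2) = 0"
      by (simp add: dft_def)
    then show ?thesis using True by (simp add: frobenius_norm_def)
  next
    case False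
    then have "n \<noteq> 0" "frobenius_norm D \<noteq> 0"
      using assms(1) frobenius_norm_eq_0_iff[OF assms(1)] by auto
    then show ?thesis
      using assms(3) False tot by (simp add: is_partial_energy_def)
  qed
qed

theorem theorem1p9:
  fixes n k :: nat
    and A B :: "complex mat"
    and \<Lambda> :: "nat \<Rightarrow> complex mat"
    and a b :: "nat \<Rightarrow> nat"
    and S T :: "nat set"
    and E w :: "nat \<Rightarrow> real"
  assumes "A \<in> carrier_mat n n" and "A \<noteq> 0\<^sub>m n n"
    and "cycle_decomposition n A \<Lambda>"
    and "B = fourier_mat n * A * mat_adjoint (fourier_mat n)"
    and "\<And>j. j \<in> {1..k} \<Longrightarrow> a j < n" and "inj_on a {1..k}" and "S = a ` {1..k}"
    and "\<And>i. i < n \<Longrightarrow> is_partial_energy n S (\<Lambda> i) (E i)"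
    and "\<And>j. j \<in> {1..k} \<Longrightarrow> b j = (if a j = 0 then 0 else n - a j)" and "T = b ` {1..k}"
    and "\<And>i. i < n \<Longrightarrow> w i = (frobenius_norm (\<Lambda> i))\<^sup>2 / (frobenius_norm A)\<^sup>2"
  shows "has_relative_magnitude n B T (\<Sum>i<n. w i * E i) \<and>
    (\<forall>i<n. 0 \<le> w i \<and> w i \<le> 1) \<and> (\<Sum>i<n. w i) = 1"
proof -
  let ?N = "\<lambda>M. (frobenius_norm M)\<^sup>2"
  let ?g = "\<lambda>i m. (cmod (dft n (\<lambda>r. \<Lambda> i $$ (r, r)) m))\<^sup>2"
  have n: "0 < n" using assms(1,2) by (cases n) auto
  have Li: "\<Lambda> i \<in> carrier_mat n n" "diagonal_mat (\<Lambda> i)" if "i < n" for i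
    using assms(3) that by (auto simp: cycle_decomposition_def)
  have NA: "?N A > 0" using assms(1,2) by (simp add: frobenius_norm_eq_0_iff)
  have B: "B \<in> carrier_mat n n"
    using assms(1) by (auto simp: assms(4) fourier_mat_def mat_adjoint_def mat_of_rows_def)
  obtain L where L: "cycle_decomposition n B L" using cycle_decomposition_exists[OF B] by blast
  have NB: "?N B = ?N A"
    unfolding assms(4) using assms(1) by (rule frobenius_norm_fourier_conjugate)
  then have B0: "B \<noteq> 0\<^sub>m n n"
    using NA by (auto simp: frobenius_norm_def)
  have S: "S \<subseteq> {..<n}" using assms(5,7) by auto
  \<comment> \<open>Passing from \<open>a\<close> to \<open>b\<close> is negation modulo \<open>n\<close>, an involution on the frequencies.\<close>
  have T: "T = (\<lambda>m. (n - m) mod n) ` S"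
    unfolding assms(7,10) image_image using assms(5,9) n by (intro image_cong refl) simp
  have inv: "(n - (n - m) mod n) mod n = m" if "m \<in> S" for m
    using mod_diff_diff[of 0 n m] n S that by auto
  have "(\<Sum>j\<in>T. ?N (L j)) = (\<Sum>m\<in>S. ?N (L ((n - m) mod n)))"
    unfolding T using inv by (subst sum.reindex) (auto intro: inj_on_inverseI[where g = "\<lambda>m. (n - m) mod n"])
  also have "\<dots> = (\<Sum>m\<in>S. (\<Sum>i<n. ?g i m) / real n)"
    using frobenius_norm_sq_fourier_cycle[OF assms(3), folded assms(4), OF L] n inv
    by (intro sum.cong refl) simp
  also have "\<dots> = (\<Sum>i<n. (\<Sum>m\<in>S. ?g i m) / real n)"
    unfolding sum_divide_distrib by (rule sum.swap)
  also have "\<dots> = (\<Sum>i<n. ?N (\<Lambda> i) * E i)"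
    using n partial_energy_sum[OF Li assms(8) S] by (intro sum.cong refl) simp
  finally have "(\<Sum>j\<in>T. ?N (L j)) / ?N B = (\<Sum>i<n. w i * E i)"
    by (simp add: NB assms(11) sum_divide_distrib)
  then have "has_relative_magnitude n B T (\<Sum>i<n. w i * E i)"
    using B0 L unfolding has_relative_magnitude_def by metis
  moreover have w0: "\<forall>i<n. 0 \<le> w i" by (simp add: assms(11))
  moreover have w1: "(\<Sum>i<n. w i) = 1"
    using NA frobenius_norm_sq_sum_cycles[OF assms(3)]
    by (simp add: assms(11) flip: sum_divide_distrib)
  moreover have "w i \<le> 1" if "i < n" for i
    using member_le_sum[of i "{..<n}" w] w0 w1 that by auto
  ultimately show ?thesis by blast
qed

end
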